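(* Let $\mathcal O=\{\mathcal O_\varepsilon\}_{0<\varepsilon\le1}$ be an increasing family of compact identity neighbourhoods in $G$ with $\mathcal O_\varepsilon^{-1}=\mathcal O_\varepsilon$, satisfying $$\mu_\Gamma(\mathcal O_\varepsilon)\ge\delta\varepsilon^d\quad\text{and}\quad\mathcal O_{\varepsilon_1}\mathcal O_{\varepsilon_2}\subseteq\mathcal O_{\eta(\varepsilon_1+\varepsilon_2)}$$ for some $\delta,d,\eta>0$. Let $\mathcal B$ be a family that is strongly $\mathcal A_{\beta,c}$-well rounded with respect to $\mathcal O$. Then for all $g\in G$ and all $B\in\mathcal B$ with $m_{\mathcal V}(B)\ge\max\{\delta^{-\frac{1}{2-\beta}},\delta^{\frac{1}{d+\beta}}\}$, $$\#(\mathcal Lg\cap B)=m_{\mathcal V}(B)+O_{d,\eta,g}\big(\delta^{-\frac{1}{d+2}}m_{\mathcal V}(B)^{1-\frac{2-\beta}{d+2}}\big).$$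
   Context: General setting: $\mathcal V\subseteq\mathbb R^N$ an algebraic variety with a transitive right action of a real unimodular algebraic group $G$; $\Gamma\le G$ a non-uniform lattice; $\mathcal L\subseteq\mathcal V$ an infinite discrete set with $\mathcal L\gamma=\mathcal L$ for $\gamma\in\Gamma$; $\mu_\Gamma$ the $G$-invariant probability measure on $\Gamma\backslash G$, also denoting the Haar measure on $G$ locally agreeing with it; $m_{\mathcal V}$ a $G$-invariant measure on $\mathcal V$ with $\int_{\Gamma\backslash G}\#(\mathcal Lg\cap B)\,d\mu_\Gamma=m_{\mathcal V}(B)$ for finite-measure Borel $B$. $D(\mathcal Lg,B)=|\#(\mathcal Lg\cap B)-m_{\mathcal V}(B)|$. For $\beta\in[1,2)$, $c>0$, $\mathcal A_{\beta,c}$ is the family of finite-measure Borel $B\subseteq\mathcal V$ with $\int_{\Gamma\backslash G}|D(\mathcal Lg,B)|^2d\mu_\Gamma(g)\le c(m_{\mathcal V}(B)^\beta+m_{\mathcal V}(B))$. A family $\mathcal B$ is strongly $\mathcal A_{\beta,c}$-well rounded with respect to $\mathcal O$ if there are $C_0\ge0$, $\varepsilon_0\in(0,1)$ such that for every $\varepsilon\in(0,\varepsilon_0)$ and $B\in\mathcal B$ there are $\underline B_\varepsilon,\overline B_\varepsilon\in\mathcal A_{\beta,c}$ with $\underline B_\varepsilon\subseteq\bigcap_{h\in\mathcal O_\varepsilon}Bh\subseteq\bigcup_{h\in\mathcal O_\varepsilon}Bh\subseteq\overline B_\varepsilon$, $m_{\mathcal V}(\overline B_\varepsilon\setminus\underline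 B_\varepsilon)\le C_0(\varepsilon m_{\mathcal V}(B)+1)$, and $\overline B_\varepsilon\setminus\underline B_\varepsilon\in\mathcal A_{\beta,c}$.
   Formalization: The implied constant may depend, besides d, η, g, on the largest neighbourhood O_1 and on the well-roundedness constants C_0, ε_0; uniformity over all families O fails, e.g. for SL_2(R)×R with primitive vectors, discs and O_ε stretched in the R factor. *)

theory Defs
  imports "HOL-Analysis.Analysis"
begin

section \<open>Real algebraic sets, groups and actions\<close>

definition zariski_closed :: "'a::euclidean_space set \<Rightarrow> bool" where
  "zariski_closed Z \<longleftrightarrow>
     (\<exists>P. (\<forall>p\<in>P. real_polynomial_function p) \<and> Z = {x. \<forall>p\<in>P. p x = 0})"

text \<open>Varieties are allowed to be locally closed, so that homogeneous spaces such as
  \<open>\<real>\<^sup>N \<setminus> {0}\<close> or a punctured light cone are included.\<close>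

definition algebraic_variety :: "'a::euclidean_space set \<Rightarrow> bool" where
  "algebraic_variety V \<longleftrightarrow> (\<exists>Z W. zariski_closed Z \<and> zariski_closed W \<and> V = Z - W)"

definition matrix_group :: "(real^'n^'n) set \<Rightarrow> bool" where
  "matrix_group G \<longleftrightarrow> mat 1 \<in> G \<and> (\<forall>g\<in>G. \<forall>h\<in>G. g ** h \<in> G) \<and>
     (\<forall>g\<in>G. invertible g \<and> matrix_inv g \<in> G)"

definition real_algebraic_group :: "(real^'n^'n) set \<Rightarrow> bool" where
  "real_algebraic_group G \<longleftrightarrow>
     matrix_group G \<and> (\<exists>Z. zariski_closed Z \<and> G = {g. invertible g} \<inter> Z)"

definition transitive_right_action ::
  "'v set \<Rightarrow> (real^'n^'n) set \<Rightarrow> ('v \<Rightarrow> real^'n^'n \<Rightarrow> 'v) \<Rightarrow> bool" where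
  "transitive_right_action V G act \<longleftrightarrow>
     (\<forall>x\<in>V. \<forall>g\<in>G. act x g \<in> V) \<and>
     (\<forall>x\<in>V. act x (mat 1) = x) \<and>
     (\<forall>x\<in>V. \<forall>g\<in>G. \<forall>h\<in>G. act (act x g) h = act x (g ** h)) \<and>
     V \<noteq> {} \<and> (\<forall>x\<in>V. \<forall>y\<in>V. \<exists>g\<in>G. act x g = y)"

text \<open>The action is a regular map \<open>V \<times> G \<rightarrow> V\<close> in the sense of real algebraic geometry: each
  coordinate is a quotient of polynomials whose denominator has no zero on \<open>V \<times> G\<close>.\<close>

definition regular_action ::
  "(real^'N) set \<Rightarrow> (real^'n^'n) set \<Rightarrow> (real^'N \<Rightarrow> real^'n^'n \<Rightarrow> real^'N) \<Rightarrow> bool" where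
  "regular_action V G act \<longleftrightarrow>
     (\<forall>i. \<exists>p q :: (real^'N) \<times> (real^'n^'n) \<Rightarrow> real.
        real_polynomial_function p \<and> real_polynomial_function q \<and>
        (\<forall>x\<in>V. \<forall>g\<in>G. q (x, g) \<noteq> 0 \<and> act x g $ i = p (x, g) / q (x, g)))"


section \<open>Haar measure\<close>

text \<open>Regularity of the measure is automatic, since \<open>G\<close> is locally compact and second
  countable.\<close>

definition left_haar_measure ::
  "(real^'n^'n) set \<Rightarrow> (real^'n^'n) measure \<Rightarrow> bool" where
  "left_haar_measure G \<mu> \<longleftrightarrow>
     sets \<mu> = sets (restrict_space borel G) \<and>
     emeasure \<mu> G \<noteq> 0 \<and>
     (\<forall>K. compact K \<and> K \<subseteq> G \<longrightarrow> emeasure \<mu> K < \<infinity>) \<and>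
     (\<forall>g\<in>G. \<forall>A\<in>sets \<mu>. emeasure \<mu> ((\<lambda>h. g ** h) ` A) = emeasure \<mu> A)"

definition unimodular :: "(real^'n^'n) set \<Rightarrow> bool" where
  "unimodular G \<longleftrightarrow>
     (\<forall>\<mu>. left_haar_measure G \<mu> \<longrightarrow>
        (\<forall>g\<in>G. \<forall>A\<in>sets \<mu>. emeasure \<mu> ((\<lambda>h. h ** g) ` A) = emeasure \<mu> A))"


section \<open>The quotient and its invariant measure\<close>

definition rcoset :: "(real^'n^'n) set \<Rightarrow> real^'n^'n \<Rightarrow> (real^'n^'n) set" where
  "rcoset \<Gamma> g = (\<lambda>\<gamma>. \<gamma> ** g) ` \<Gamma>"

definition quotient_topology ::
  "(real^'n^'n) set \<Rightarrow> (real^'n^'n) set \<Rightarrow> (real^'n^'n) set topology" where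
  "quotient_topology \<Gamma> G =
     topology (\<lambda>S. S \<subseteq> rcoset \<Gamma> ` G \<and> openin (top_of_set G) {g\<in>G. rcoset \<Gamma> g \<in> S})"

lemma openin_quotient_topology:
  "openin (quotient_topology \<Gamma> G) S \<longleftrightarrow>
     S \<subseteq> rcoset \<Gamma> ` G \<and> openin (top_of_set G) {g\<in>G. rcoset \<Gamma> g \<in> S}"
proof -
  define pre where "pre = (\<lambda>S. {g\<in>G. rcoset \<Gamma> g \<in> S})"
  have pre_Int: "pre (S \<inter> T) = pre S \<inter> pre T" for S T
    unfolding pre_def by blast
  have pre_Union: "pre (\<Union>K) = \<Union>(pre ` K)" for K
    unfolding pre_def by blast
  have "istopology (\<lambda>S. S \<subseteq> rcoset \<Gamma> ` G \<and> openin (top_of_set G) (pre S))"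
    unfolding istopology_def
  proof (intro conjI allI impI)
    fix S T
    assume S: "S \<subseteq> rcoset \<Gamma> ` G \<and> openin (top_of_set G) (pre S)"
      and T: "T \<subseteq> rcoset \<Gamma> ` G \<and> openin (top_of_set G) (pre T)"
    show "S \<inter> T \<subseteq> rcoset \<Gamma> ` G"
      using S by (rule conjE) (rule le_infI1)
    show "openin (top_of_set G) (pre (S \<inter> T))"
      unfolding pre_Int by (rule openin_Int[OF conjunct2[OF S] conjunct2[OF T]])
  next
    fix K
    assume K: "\<forall>S\<in>K. S \<subseteq> rcoset \<Gamma> ` G \<and> openin (top_of_set G) (pre S)"
    show "\<Union>K \<subseteq> rcoset \<Gamma> ` G"
      by (rule Union_least) (rule conjunct1[OF bspec[OF K]])
    have "openin (top_of_set G) T" if T: "T \<in> pre ` K" for T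
      using T by (rule imageE) (simp only: conjunct2[OF bspec[OF K]])
    then show "openin (top_of_set G) (pre (\<Union>K))"
      unfolding pre_Union by (rule openin_Union)
  qed
  then show ?thesis
    unfolding quotient_topology_def pre_def by (simp only: topology_inverse')
qed

definition quotient_borel ::
  "(real^'n^'n) set \<Rightarrow> (real^'n^'n) set \<Rightarrow> (real^'n^'n) set measure" where
  "quotient_borel \<Gamma> G = sigma (rcoset \<Gamma> ` G) {S. openin (quotient_topology \<Gamma> G) S}"

definition invariant_prob_measure ::
  "(real^'n^'n) set \<Rightarrow> (real^'n^'n) set \<Rightarrow> (real^'n^'n) set measure \<Rightarrow> bool" where
  "invariant_prob_measure \<Gamma> G \<nu> \<longleftrightarrow>
     sets \<nu> = sets (quotient_borel \<Gamma> G) \<and>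
     emeasure \<nu> (rcoset \<Gamma> ` G) = 1 \<and>
     (\<forall>g\<in>G. \<forall>S\<in>sets \<nu>. emeasure \<nu> ((\<lambda>C. (\<lambda>h. h ** g) ` C) ` S) = emeasure \<nu> S)"

definition non_uniform_lattice :: "(real^'n^'n) set \<Rightarrow> (real^'n^'n) set \<Rightarrow> bool" where
  "non_uniform_lattice \<Gamma> G \<longleftrightarrow>
     matrix_group \<Gamma> \<and> \<Gamma> \<subseteq> G \<and> discrete \<Gamma> \<and>
     (\<exists>\<nu>. invariant_prob_measure \<Gamma> G \<nu>) \<and>
     \<not> compact_space (quotient_topology \<Gamma> G)"

text \<open>The Haar measure \<open>\<mu>\<close> on \<open>G\<close> agrees with the measure \<open>\<nu>\<close> on \<open>\<Gamma>\<setminus>G\<close> on Borel sets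
  that project injectively.\<close>

definition locally_agrees ::
  "(real^'n^'n) set \<Rightarrow> (real^'n^'n) measure \<Rightarrow> (real^'n^'n) set measure \<Rightarrow> bool" where
  "locally_agrees \<Gamma> \<mu> \<nu> \<longleftrightarrow>
     (\<forall>A\<in>sets \<mu>. inj_on (rcoset \<Gamma>) A \<longrightarrow> emeasure \<mu> A = emeasure \<nu> (rcoset \<Gamma> ` A))"


section \<open>Discrete sets in homogeneous varieties and their discrepancy\<close>

text \<open>For a coset \<open>C = \<Gamma>g\<close> and a \<open>\<Gamma>\<close>-invariant set \<open>L\<close> this is \<open>Lg\<close>, so that
  functions of \<open>Lg\<close> become functions on \<open>\<Gamma>\<setminus>G\<close>.\<close>

definition coset_translate ::
  "('v \<Rightarrow> real^'n^'n \<Rightarrow> 'v) \<Rightarrow> 'v set \<Rightarrow> (real^'n^'n) set \<Rightarrow> 'v set" where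
  "coset_translate act L C = {act x h |x h. x \<in> L \<and> h \<in> C}"

text \<open>Here \<open>\<nu>\<close> is the probability measure on \<open>\<Gamma>\<setminus>G\<close> and \<open>\<mu>\<close> the compatible Haar
  measure on \<open>G\<close>.\<close>

locale homogeneous_point_set =
  fixes V :: "(real^'N) set"
    and G \<Gamma> :: "(real^'n^'n) set"
    and act :: "real^'N \<Rightarrow> real^'n^'n \<Rightarrow> real^'N"
    and L :: "(real^'N) set"
    and \<mu> :: "(real^'n^'n) measure"
    and \<nu> :: "(real^'n^'n) set measure"
    and m :: "(real^'N) measure"
  assumes variety: "algebraic_variety V"
    and group: "real_algebraic_group G"
    and unimodular: "unimodular G"
    and action: "transitive_right_action V G act"
    and regular: "regular_action V G act"
    and lattice: "non_uniform_lattice \<Gamma> G"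
    and points: "L \<subseteq> V" "infinite L" "discrete L"
    and points_invariant: "\<And>\<gamma>. \<gamma> \<in> \<Gamma> \<Longrightarrow> (\<lambda>x. act x \<gamma>) ` L = L"
    and quotient_measure: "invariant_prob_measure \<Gamma> G \<nu>"
    and haar: "left_haar_measure G \<mu>"
    and agree: "locally_agrees \<Gamma> \<mu> \<nu>"
    and sets_m: "sets m = sets (restrict_space borel V)"
    and m_invariant: "\<And>g B. g \<in> G \<Longrightarrow> B \<in> sets m \<Longrightarrow>
          emeasure m ((\<lambda>x. act x g) ` B) = emeasure m B"
    and mean_value: "\<And>B. B \<in> sets m \<Longrightarrow> emeasure m B < \<infinity> \<Longrightarrow>
          (\<integral>\<^sup>+ C. emeasure (count_space UNIV) (coset_translate act L C \<inter> B) \<partial>\<nu>) = emeasure m B"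

text \<open>\<open>card\<close> of an infinite set is \<open>0\<close>, so infinite counts are treated separately.\<close>

definition discrepancy :: "'v measure \<Rightarrow> 'v set \<Rightarrow> 'v set \<Rightarrow> ennreal" where
  "discrepancy m X B =
     (if finite (X \<inter> B) then ennreal \<bar>real (card (X \<inter> B)) - measure m B\<bar> else \<infinity>)"

definition variance_class ::
  "('v \<Rightarrow> real^'n^'n \<Rightarrow> 'v) \<Rightarrow> 'v set \<Rightarrow> (real^'n^'n) set measure \<Rightarrow> 'v measure \<Rightarrow>
   real \<Rightarrow> real \<Rightarrow> 'v set set" where
  "variance_class act L \<nu> m \<beta> c =
     {B \<in> sets m. emeasure m B < \<infinity> \<and>
        (\<integral>\<^sup>+ C. (discrepancy m (coset_translate act L C) B)\<^sup>2 \<partial>\<nu>)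
          \<le> ennreal (c * (measure m B powr \<beta> + measure m B))}"

text \<open>Strong well-roundedness with respect to a class \<open>\<A>\<close> of sets, with its constants
  \<open>C\<^sub>0\<close> and \<open>\<epsilon>\<^sub>0\<close> made explicit.\<close>

definition strongly_well_rounded ::
  "('v \<Rightarrow> real^'n^'n \<Rightarrow> 'v) \<Rightarrow> 'v measure \<Rightarrow> 'v set set \<Rightarrow> (real \<Rightarrow> (real^'n^'n) set) \<Rightarrow>
   real \<Rightarrow> real \<Rightarrow> 'v set set \<Rightarrow> bool" where
  "strongly_well_rounded act m \<A> \<O> C\<^sub>0 \<epsilon>\<^sub>0 \<B> \<longleftrightarrow>
     0 \<le> C\<^sub>0 \<and> 0 < \<epsilon>\<^sub>0 \<and> \<epsilon>\<^sub>0 < 1 \<and>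
     (\<forall>\<epsilon>. 0 < \<epsilon> \<and> \<epsilon> < \<epsilon>\<^sub>0 \<longrightarrow> (\<forall>B\<in>\<B>. \<exists>B\<^sub>1\<in>\<A>. \<exists>B\<^sub>2\<in>\<A>.
        B\<^sub>1 \<subseteq> (\<Inter>h\<in>\<O> \<epsilon>. (\<lambda>x. act x h) ` B) \<and>
        (\<Union>h\<in>\<O> \<epsilon>. (\<lambda>x. act x h) ` B) \<subseteq> B\<^sub>2 \<and>
        measure m (B\<^sub>2 - B\<^sub>1) \<le> C\<^sub>0 * (\<epsilon> * measure m B + 1) \<and>
        B\<^sub>2 - B\<^sub>1 \<in> \<A>))"

text \<open>Only the sets \<open>\<O> \<epsilon>\<close> with \<open>0 < \<epsilon> \<le> 1\<close> matter; the product condition is imposed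
  whenever all three indices lie in this range.\<close>

definition identity_neighbourhoods ::
  "(real^'n^'n) set \<Rightarrow> (real^'n^'n) measure \<Rightarrow> real \<Rightarrow> real \<Rightarrow> real \<Rightarrow>
   (real \<Rightarrow> (real^'n^'n) set) \<Rightarrow> bool" where
  "identity_neighbourhoods G \<mu> \<delta> d \<eta> \<O> \<longleftrightarrow>
     (\<forall>\<epsilon>. 0 < \<epsilon> \<and> \<epsilon> \<le> 1 \<longrightarrow>
        \<O> \<epsilon> \<subseteq> G \<and> compact (\<O> \<epsilon>) \<and>
        (\<exists>U. openin (top_of_set G) U \<and> mat 1 \<in> U \<and> U \<subseteq> \<O> \<epsilon>) \<and>
        matrix_inv ` \<O> \<epsilon> = \<O> \<epsilon> \<and>
        ennreal (\<delta> * \<epsilon> powr d) \<le> emeasure \<mu> (\<O> \<epsilon>)) \<and>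
     (\<forall>\<epsilon> \<epsilon>'. 0 < \<epsilon> \<and> \<epsilon> \<le> \<epsilon>' \<and> \<epsilon>' \<le> 1 \<longrightarrow> \<O> \<epsilon> \<subseteq> \<O> \<epsilon>') \<and>
     (\<forall>\<epsilon>\<^sub>1 \<epsilon>\<^sub>2. 0 < \<epsilon>\<^sub>1 \<and> \<epsilon>\<^sub>1 \<le> 1 \<and> 0 < \<epsilon>\<^sub>2 \<and> \<epsilon>\<^sub>2 \<le> 1 \<and> \<eta> * (\<epsilon>\<^sub>1 + \<epsilon>\<^sub>2) \<le> 1 \<longrightarrow>
        (\<forall>g\<in>\<O> \<epsilon>\<^sub>1. \<forall>h\<in>\<O> \<epsilon>\<^sub>2. g ** h \<in> \<O> (\<eta> * (\<epsilon>\<^sub>1 + \<epsilon>\<^sub>2))))"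

end

theory Submission
  imports Defs
begin

text \<open>
  Suppose \<open>#(Lg \<inter> B)\<close> exceeds \<open>m(B)\<close> by much more than \<open>m(B\<^sub>2 - B\<^sub>1)\<close>. As \<open>Bh \<subseteq> B\<^sub>2\<close>, the set
  \<open>Lgh\<close> has large discrepancy with respect to \<open>B\<^sub>2\<close> for every \<open>h \<in> \<O> \<epsilon>\<close>. The cosets \<open>\<Gamma>gh\<close> fill a
  set of measure at least \<open>\<mu>(\<O> \<epsilon>) / p\<close>, where \<open>p\<close> is the number of sets injecting into \<open>\<Gamma>\<setminus>G\<close>
  that are needed to cover \<open>g \<O> 1\<close>; this contradicts the variance bound for \<open>B\<^sub>2\<close>. If
  \<open>#(Lg \<inter> B)\<close> is too small, the same argument applies to \<open>B\<^sub>1\<close>. The two error terms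
  \<open>\<epsilon> m(B)\<close> and \<open>sqrt (m(B) powr \<beta> / (\<delta> * \<epsilon> powr d))\<close> balance at
  \<open>\<epsilon> = \<delta> powr (- 1 / (d + 2)) * m(B) powr (- (2 - \<beta>) / (d + 2))\<close>.
\<close>

section \<open>Matrix multiplication and local injectivity of the projection to the quotient\<close>

lemma bounded_bilinear_matrix_matrix_mult:
  "bounded_bilinear ((**) :: real^'n^'m \<Rightarrow> real^'p^'n \<Rightarrow> real^'p^'m)"
proof -
  have "bilinear ((**) :: real^'n^'m \<Rightarrow> real^'p^'n \<Rightarrow> real^'p^'m)"
    unfolding bilinear_def
  proof (intro conjI allI linearI)
    fix A C :: "real^'n^'m" and B D :: "real^'p^'n" and r :: real
    show "A ** (B + D) = A ** B + A ** D"
      by (rule matrix_add_ldistrib)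
    show "(A + C) ** B = A ** B + C ** B"
      by (simp add: matrix_matrix_mult_def vec_eq_iff sum.distrib distrib_right)
    show "(r *\<^sub>R A) ** B = r *\<^sub>R (A ** B)"
      by (rule scalar_matrix_assoc[symmetric])
    then show "A ** (r *\<^sub>R B) = r *\<^sub>R (A ** B)"
      by (simp only: matrix_scalar_ac)
  qed
  then show ?thesis
    by (simp add: bilinear_conv_bounded_bilinear)
qed

lemma compact_matrix_mult_image:
  fixes g :: "real^'n^'m" and Q :: "(real^'p^'n) set"
  shows "compact Q \<Longrightarrow> compact ((**) g ` Q)"
  using bounded_linear.continuous_on[OF
      bounded_bilinear.bounded_linear_right[OF bounded_bilinear_matrix_matrix_mult] continuous_on_id]
  by (rule compact_continuous_image)

text \<open>If \<open>x = \<gamma> ** y\<close> with both points near \<open>x0\<close>, then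
  \<open>(\<gamma> - mat 1) ** x0 = x - x0 + \<gamma> ** (x0 - y)\<close> is small. Cancelling
  \<open>x0\<close> puts \<open>\<gamma>\<close> within the isolation radius of the identity in
  \<Gamma>, so \<open>\<gamma> = mat 1\<close>.\<close>

lemma locally_inj_on_rcoset:
  fixes \<Gamma> :: "(real^'n^'n) set"
  assumes one: "mat 1 \<in> \<Gamma>" and "discrete \<Gamma>" and x0: "invertible x0"
  obtains e where "0 < e" "inj_on (rcoset \<Gamma>) (ball x0 e)"
proof -
  interpret M: bounded_bilinear "(**) :: real^'n^'n \<Rightarrow> real^'n^'n \<Rightarrow> real^'n^'n"
    by (rule bounded_bilinear_matrix_matrix_mult)
  obtain K where K: "0 < K" "\<And>(a :: real^'n^'n) (b :: real^'n^'n). norm (a ** b) \<le> norm a * norm b * K"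
    using bounded_bilinear.pos_bounded[OF bounded_bilinear_matrix_matrix_mult] by blast
  have "mat 1 isolated_in \<Gamma>"
    using one \<open>discrete \<Gamma>\<close> by (rule discreteD[rotated])
  then obtain r where r: "0 < r" "\<And>\<gamma>. \<gamma> \<in> \<Gamma> \<Longrightarrow> dist (mat 1) \<gamma> < r \<Longrightarrow> \<gamma> = mat 1"
    unfolding isolated_in_dist_Ex_iff by blast
  obtain z where z: "x0 ** z = mat 1"
    using x0 unfolding invertible_def by blast
  \<comment> \<open>No bound on \<open>norm \<gamma>\<close> is known in advance, so it is estimated
    by \<open>norm (\<gamma> - mat 1) + I\<close>. The radius \<open>e\<close> is so small that the
    resulting coefficient of \<open>norm (\<gamma> - mat 1)\<close> is at most 1/2 and can be
    absorbed on the left, while the rest is at most \<open>r/4\<close>; \<open>s\<close> dominates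
    both constants that multiply \<open>e\<close>.\<close>
  define a where "a = norm z * K"
  define I where "I = norm (mat 1 :: real^'n^'n)"
  define s where "s = 1 + a + I * K * a + K * a"
  define e where "e = min (r/4) (1/2) / s"
  have a: "0 \<le> a" "0 \<le> I" using K by (auto simp: a_def I_def)
  have s: "0 < s" "a + I * K * a \<le> s" "K * a \<le> s"
    using a K(1) by (auto simp: s_def add_pos_nonneg)
  have e: "0 < e" using r s by (simp add: e_def)
  have es: "e * s = min (r/4) (1/2)" using s by (simp add: e_def)
  have e1: "e * (a + I * K * a) \<le> r/4"
    using mult_left_mono[OF s(2), of e] e es by linarith
  have e2: "e * (K * a) \<le> 1/2"
    using mult_left_mono[OF s(3), of e] e es by linarith
  have "inj_on (rcoset \<Gamma>) (ball x0 e)"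
  proof (rule inj_onI)
    fix x y assume x: "x \<in> ball x0 e" and y: "y \<in> ball x0 e" and eq: "rcoset \<Gamma> x = rcoset \<Gamma> y"
    have "x \<in> rcoset \<Gamma> x"
      using one unfolding rcoset_def by (metis imageI matrix_mul_lid)
    then obtain \<gamma> where \<gamma>: "\<gamma> \<in> \<Gamma>" "x = \<gamma> ** y"
      unfolding eq by (auto simp: rcoset_def)
    have "(x - x0 + \<gamma> ** (x0 - y)) ** z = (\<gamma> - mat 1) ** (x0 ** z)"
      unfolding \<gamma>(2) by (simp add: M.diff_left M.diff_right M.add_left matrix_mul_assoc)
    then have "\<gamma> - mat 1 = (x - x0 + \<gamma> ** (x0 - y)) ** z"
      by (simp add: z)
    then have "norm (\<gamma> - mat 1) \<le> norm (x - x0 + \<gamma> ** (x0 - y)) * a"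
      using K(2)[of "x - x0 + \<gamma> ** (x0 - y)" z] by (simp add: a_def mult_ac)
    also have "\<dots> \<le> (e + norm \<gamma> * e * K) * a"
    proof (rule mult_right_mono)
      have "norm (\<gamma> ** (x0 - y)) \<le> norm \<gamma> * norm (x0 - y) * K" by (rule K)
      also have "\<dots> \<le> norm \<gamma> * e * K"
        using y K(1) by (intro mult_right_mono mult_left_mono) (auto simp: dist_norm)
      finally show "norm (x - x0 + \<gamma> ** (x0 - y)) \<le> e + norm \<gamma> * e * K"
        using x norm_triangle_ineq[of "x - x0" "\<gamma> ** (x0 - y)"]
        by (auto simp: dist_norm norm_minus_commute)
    qed (rule a)
    also have "\<dots> \<le> (e + (norm (\<gamma> - mat 1) + I) * e * K) * a"
      using e K(1) a norm_triangle_ineq[of "\<gamma> - mat 1" "mat 1"]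
      by (intro mult_right_mono add_left_mono) (auto simp: I_def)
    also have "\<dots> = e * (a + I * K * a) + norm (\<gamma> - mat 1) * (e * (K * a))"
      by (simp add: algebra_simps)
    also have "\<dots> \<le> r/4 + norm (\<gamma> - mat 1) * (1/2)"
      using e1 e2 by (intro add_mono mult_left_mono) auto
    finally have le: "norm (\<gamma> - mat 1) < r" using r(1) by simp
    show "x = y"
      using r(2)[OF \<gamma>(1)] \<gamma>(2) le by (simp add: dist_norm norm_minus_commute)
  qed
  then show thesis using that e by blast
qed

section \<open>The action, translates of the point set and Markov's inequality on the
  quotient\<close>

context homogeneous_point_set
begin

lemma matrix_group_G: "matrix_group G"
  using group unfolding real_algebraic_group_def by blast

lemma mult_in_G: "g \<in> G \<Longrightarrow> h \<in> G \<Longrightarrow> g ** h \<in> G"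
  using matrix_group_G unfolding matrix_group_def by blast

lemma act_in_V: "x \<in> V \<Longrightarrow> g \<in> G \<Longrightarrow> act x g \<in> V"
  using action unfolding transitive_right_action_def by blast

lemma act_mat_1: "x \<in> V \<Longrightarrow> act x (mat 1) = x"
  using action unfolding transitive_right_action_def by blast

lemma act_act: "x \<in> V \<Longrightarrow> g \<in> G \<Longrightarrow> h \<in> G \<Longrightarrow> act (act x g) h = act x (g ** h)"
  using action unfolding transitive_right_action_def by blast

lemma inj_on_act:
  assumes "g \<in> G"
  shows "inj_on (\<lambda>x. act x g) V"
proof -
  have inv: "invertible g" "matrix_inv g \<in> G"
    using assms matrix_group_G unfolding matrix_group_def by auto
  have "g ** matrix_inv g = mat 1"
    using someI_ex[OF inv(1)[unfolded invertible_def]] unfolding matrix_inv_def by blast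
  then have "act (act x g) (matrix_inv g) = x" if "x \<in> V" for x
    using that assms inv(2) by (simp add: act_act act_mat_1)
  then show ?thesis by (rule inj_on_inverseI)
qed

lemma space_m: "space m = V"
  using sets_eq_imp_space_eq[OF sets_m] by (simp add: space_restrict_space)

text \<open>Each \<open>\<gamma>\<close> maps \<open>L\<close> onto itself and is absorbed. This
  links the sets in the variance integral over the quotient with the translates whose points are
  counted.\<close>

lemma coset_translate_rcoset:
  assumes "g \<in> G"
  shows "coset_translate act L (rcoset \<Gamma> g) = (\<lambda>x. act x g) ` L"
proof -
  have \<Gamma>: "mat 1 \<in> \<Gamma>" "\<Gamma> \<subseteq> G"
    using lattice unfolding non_uniform_lattice_def matrix_group_def by auto
  have "coset_translate act L (rcoset \<Gamma> g) = (\<Union>\<gamma>\<in>\<Gamma>. (\<lambda>x. act x (\<gamma> ** g)) ` L)"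
    unfolding coset_translate_def rcoset_def by blast
  also have "\<dots> = (\<Union>\<gamma>\<in>\<Gamma>. (\<lambda>x. act x g) ` (\<lambda>x. act x \<gamma>) ` L)"
  proof (rule SUP_cong[OF refl])
    fix \<gamma> assume "\<gamma> \<in> \<Gamma>"
    then have "act x (\<gamma> ** g) = act (act x \<gamma>) g" if "x \<in> L" for x
      using act_act[of x \<gamma> g] assms \<Gamma>(2) points(1) that by (metis subsetD)
    then show "(\<lambda>x. act x (\<gamma> ** g)) ` L = (\<lambda>x. act x g) ` (\<lambda>x. act x \<gamma>) ` L"
      by (simp add: image_image cong: image_cong)
  qed
  also have "\<dots> = (\<lambda>x. act x g) ` L"
    using \<Gamma>(1) points_invariant by auto
  finally show ?thesis .
qed

text \<open>The integral of a non-measurable function is a lower integral, and a non-measurable set has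
  measure \<open>0\<close>; so neither \<open>f\<close> nor the image of \<open>A\<close> in \<open>\<Gamma>\<setminus>G\<close> has to be measurable.\<close>

lemma haar_markov_inequality:
  assumes "compact Q" "Q \<subseteq> G"
  obtains p :: nat where "\<And>A f t. A \<in> sets \<mu> \<Longrightarrow> A \<subseteq> Q \<Longrightarrow> (\<And>a. a \<in> A \<Longrightarrow> t \<le> f (rcoset \<Gamma> a)) \<Longrightarrow>
      t * emeasure \<mu> A \<le> of_nat p * (\<integral>\<^sup>+ C. f C \<partial>\<nu>)"
proof -
  have \<Gamma>: "mat 1 \<in> \<Gamma>" "discrete \<Gamma>"
    using lattice unfolding non_uniform_lattice_def matrix_group_def by auto
  have "\<exists>e>0. inj_on (rcoset \<Gamma>) (ball x e)" if "x \<in> Q" for x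
  proof -
    have "invertible x"
      using that assms(2) matrix_group_G unfolding matrix_group_def by blast
    then show ?thesis
      using locally_inj_on_rcoset[OF \<Gamma>] by metis
  qed
  then obtain e where e: "\<And>x. x \<in> Q \<Longrightarrow> 0 < e x \<and> inj_on (rcoset \<Gamma>) (ball x (e x))"
    by metis
  \<comment> \<open>The cover is fixed before \<open>A\<close>, \<open>f\<close> and
    \<open>t\<close>, so the number \<open>card F\<close> of balls serves for all of them.\<close>
  obtain F where F: "F \<subseteq> Q" "finite F" "Q \<subseteq> (\<Union>x\<in>F. ball x (e x))"
    using compactE_image[OF \<open>compact Q\<close>, of Q "\<lambda>x. ball x (e x)"] e
    by (metis (no_types, lifting) UN_I centre_in_ball open_ball subsetI)
  have sets_\<mu>: "sets \<mu> = sets (restrict_space borel G)"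
    using haar unfolding left_haar_measure_def by blast
  have "t * emeasure \<mu> A \<le> of_nat (card F) * (\<integral>\<^sup>+ C. f C \<partial>\<nu>)"
    if A: "A \<in> sets \<mu>" "A \<subseteq> Q" and f: "\<And>a. a \<in> A \<Longrightarrow> t \<le> f (rcoset \<Gamma> a)" for A f t
  proof -
    \<comment> \<open>On one ball the projection is injective, so \<open>agree\<close> transports
      the Haar measure to the quotient, where the claim is Markov's inequality. The pieces are added
      up by subadditivity, which costs the factor \<open>card F\<close>.\<close>
    have piece: "t * emeasure \<mu> (A \<inter> ball x (e x)) \<le> (\<integral>\<^sup>+ C. f C \<partial>\<nu>)"
      and piece_sets: "A \<inter> ball x (e x) \<in> sets \<mu>" if "x \<in> F" for x
    proof -
      let ?P = "A \<inter> ball x (e x)"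
      have "G \<inter> ball x (e x) \<in> sets \<mu>"
        unfolding sets_\<mu> by (auto simp: sets_restrict_space)
      moreover have "?P = A \<inter> (G \<inter> ball x (e x))"
        using A(2) assms(2) by blast
      ultimately show P: "?P \<in> sets \<mu>" using A(1) by auto
      have "inj_on (rcoset \<Gamma>) ?P"
        using e[of x] F(1) that by (auto intro: inj_on_subset)
      then have "emeasure \<mu> ?P = emeasure \<nu> (rcoset \<Gamma> ` ?P)"
        using agree P unfolding locally_agrees_def by blast
      moreover have "t * emeasure \<nu> (rcoset \<Gamma> ` ?P) \<le> (\<integral>\<^sup>+ C. f C \<partial>\<nu>)"
      proof (cases "rcoset \<Gamma> ` ?P \<in> sets \<nu>")
        case True
        then have "t * emeasure \<nu> (rcoset \<Gamma> ` ?P)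
            = (\<integral>\<^sup>+ C. t * indicator (rcoset \<Gamma> ` ?P) C \<partial>\<nu>)"
          by (simp add: nn_integral_cmult_indicator)
        also have "\<dots> \<le> (\<integral>\<^sup>+ C. f C \<partial>\<nu>)"
          using f by (intro nn_integral_mono) (auto simp: indicator_def)
        finally show ?thesis .
      qed (simp add: emeasure_notin_sets)
      ultimately show "t * emeasure \<mu> ?P \<le> (\<integral>\<^sup>+ C. f C \<partial>\<nu>)" by simp
    qed
    have "A = (\<Union>x\<in>F. A \<inter> ball x (e x))"
      using A(2) F(3) by blast
    then have "emeasure \<mu> A \<le> (\<Sum>x\<in>F. emeasure \<mu> (A \<inter> ball x (e x)))"
      using emeasure_subadditive_finite[OF F(2), of "\<lambda>x. A \<inter> ball x (e x)" \<mu>] piece_sets by auto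
    then have "t * emeasure \<mu> A \<le> (\<Sum>x\<in>F. t * emeasure \<mu> (A \<inter> ball x (e x)))"
      unfolding sum_distrib_left[symmetric] by (rule mult_left_mono) simp
    also have "\<dots> \<le> of_nat (card F) * (\<integral>\<^sup>+ C. f C \<partial>\<nu>)"
      using piece by (rule sum_bounded_above)
    finally show ?thesis .
  qed
  then show thesis by (rule that)
qed

section \<open>Comparing counts before and after translation\<close>

text \<open>Translation by \<open>h\<close> is injective and sends the points in \<open>B\<close> to
  points of the translated set in \<open>B\<^sub>2\<close>. Finiteness is transferred separately
  because \<open>card\<close> is 0 on infinite sets.\<close>

lemma card_translate_le:
  assumes g: "g \<in> G" and h: "h \<in> G" and B: "B \<subseteq> V"
    and B\<^sub>2: "(\<lambda>x. act x h) ` B \<subseteq> B\<^sub>2"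
    and fin: "finite ((\<lambda>x. act x (g ** h)) ` L \<inter> B\<^sub>2)"
  shows "finite ((\<lambda>x. act x g) ` L \<inter> B)"
    and "card ((\<lambda>x. act x g) ` L \<inter> B) \<le> card ((\<lambda>x. act x (g ** h)) ` L \<inter> B\<^sub>2)"
proof -
  let ?X = "(\<lambda>x. act x g) ` L \<inter> B"
  have inj: "inj_on (\<lambda>x. act x h) ?X"
    using inj_on_act[OF h] B by (rule_tac inj_on_subset) auto
  have sub: "(\<lambda>x. act x h) ` ?X \<subseteq> (\<lambda>x. act x (g ** h)) ` L \<inter> B\<^sub>2"
    using B\<^sub>2 act_act[OF _ g h] points(1) by auto
  show "finite ?X"
    using inj sub fin by (metis finite_imageD finite_subset)
  show "card ?X \<le> card ((\<lambda>x. act x (g ** h)) ` L \<inter> B\<^sub>2)"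
    using inj sub fin by (metis card_inj_on_le)
qed

text \<open>A point of the translated set in \<open>B\<^sub>1\<close> has the form
  \<open>act b h\<close> with \<open>b\<close> in \<open>B\<close>. Injectivity of the action of
  \<open>h\<close> identifies \<open>b\<close> with a point of the original translate, so no new
  points appear.\<close>

lemma card_translate_ge:
  assumes g: "g \<in> G" and h: "h \<in> G" and B: "B \<subseteq> V"
    and B\<^sub>1: "B\<^sub>1 \<subseteq> (\<lambda>x. act x h) ` B"
    and fin: "finite ((\<lambda>x. act x g) ` L \<inter> B)"
  shows "finite ((\<lambda>x. act x (g ** h)) ` L \<inter> B\<^sub>1)"
    and "card ((\<lambda>x. act x (g ** h)) ` L \<inter> B\<^sub>1) \<le> card ((\<lambda>x. act x g) ` L \<inter> B)"
proof -
  have sub: "(\<lambda>x. act x (g ** h)) ` L \<inter> B\<^sub>1 \<subseteq> (\<lambda>x. act x h) ` ((\<lambda>x. act x g) ` L \<inter> B)"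
  proof
    fix y assume y: "y \<in> (\<lambda>x. act x (g ** h)) ` L \<inter> B\<^sub>1"
    then obtain x where x: "x \<in> L" "y = act (act x g) h"
      using act_act[OF _ g h] points(1) by auto
    obtain b where b: "b \<in> B" "y = act b h" using y B\<^sub>1 by blast
    have "act x g = b"
      using inj_onD[OF inj_on_act[OF h]] x b B points(1) act_in_V[OF _ g] by (metis subsetD)
    then show "y \<in> (\<lambda>x. act x h) ` ((\<lambda>x. act x g) ` L \<inter> B)"
      using x b by blast
  qed
  show "finite ((\<lambda>x. act x (g ** h)) ` L \<inter> B\<^sub>1)"
    using sub fin by (metis finite_imageI finite_subset)
  show "card ((\<lambda>x. act x (g ** h)) ` L \<inter> B\<^sub>1) \<le> card ((\<lambda>x. act x g) ` L \<inter> B)"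
    using sub fin by (metis card_image_le card_mono finite_imageI le_trans)
qed

section \<open>From the variance bound to individual counts\<close>

text \<open>Chebyshev's inequality on \<open>g ** U\<close>, which has the Haar measure of
  \<open>U\<close> by left invariance. Assuming \<open>markov\<close> for the larger set
  \<open>Q\<close> keeps \<open>p\<close> fixed when \<open>U\<close> shrinks.\<close>

lemma variance_class_lower_bound:
  assumes markov: "\<And>A f t. A \<in> sets \<mu> \<Longrightarrow> A \<subseteq> (**) g ` Q \<Longrightarrow> (\<And>a. a \<in> A \<Longrightarrow> t \<le> f (rcoset \<Gamma> a)) \<Longrightarrow>
      t * emeasure \<mu> A \<le> of_nat p * (\<integral>\<^sup>+ C. f C \<partial>\<nu>)"
    and g: "g \<in> G" and U: "compact U" "U \<subseteq> G" "U \<subseteq> Q"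
    and v: "0 \<le> v" "ennreal v \<le> emeasure \<mu> U"
    and S: "S \<in> variance_class act L \<nu> m \<beta> c" and "0 \<le> c"
    and T: "0 \<le> T" "\<And>h. h \<in> U \<Longrightarrow> ennreal T \<le> discrepancy m ((\<lambda>x. act x (g ** h)) ` L) S"
  shows "T\<^sup>2 * v \<le> real p * (c * (measure m S powr \<beta> + measure m S))"
proof -
  let ?A = "(**) g ` U"
  let ?W = "c * (measure m S powr \<beta> + measure m S)"
  have W: "0 \<le> ?W" using \<open>0 \<le> c\<close> by simp
  have "compact ?A"
    using U(1) by (rule compact_matrix_mult_image)
  moreover have "?A \<subseteq> G" using U(2) mult_in_G[OF g] by blast
  moreover have "X \<in> sets \<mu>" if "compact X" "X \<subseteq> G" for X
  proof -
    have "G \<inter> X \<in> sets (restrict_space borel G)"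
      using borel_compact[OF that(1)] by (simp add: sets_restrict_space)
    then show ?thesis
      using haar that(2) unfolding left_haar_measure_def by (simp add: Int_absorb1)
  qed
  ultimately have A: "?A \<in> sets \<mu>" and U\<mu>: "U \<in> sets \<mu>"
    using U(1,2) by blast+
  have "ennreal (T\<^sup>2 * v) = (ennreal T)\<^sup>2 * ennreal v"
    using T(1) v(1) by (simp add: ennreal_mult ennreal_power)
  also have "\<dots> \<le> (ennreal T)\<^sup>2 * emeasure \<mu> ?A"
    using haar g U\<mu> v(2) unfolding left_haar_measure_def by (auto intro: mult_left_mono)
  also have "\<dots> \<le> of_nat p * (\<integral>\<^sup>+ C. (discrepancy m (coset_translate act L C) S)\<^sup>2 \<partial>\<nu>)"
  proof (rule markov[OF A])
    show "?A \<subseteq> (**) g ` Q" using U(3) by blast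
    show "(ennreal T)\<^sup>2 \<le> (discrepancy m (coset_translate act L (rcoset \<Gamma> a)) S)\<^sup>2" if a: "a \<in> ?A" for a
    proof -
      obtain h where h: "h \<in> U" "a = g ** h" using a by blast
      then have "coset_translate act L (rcoset \<Gamma> a) = (\<lambda>x. act x (g ** h)) ` L"
        using coset_translate_rcoset mult_in_G[OF g] U(2) by blast
      then show ?thesis using T(2)[OF h(1)] by (simp add: power_mono)
    qed
  qed
  also have "\<dots> \<le> of_nat p * ennreal ?W"
    using S unfolding variance_class_def by (auto intro: mult_left_mono)
  also have "\<dots> = ennreal (real p * ?W)"
    using W by (simp add: ennreal_mult ennreal_of_nat_eq_real_of_nat)
  finally show ?thesis
    using W by (simp add: ennreal_le_iff)
qed

lemma lattice_count_deviation:
  assumes markov: "\<And>A f t. A \<in> sets \<mu> \<Longrightarrow> A \<subseteq> (**) g ` Q \<Longrightarrow> (\<And>a. a \<in> A \<Longrightarrow> t \<le> f (rcoset \<Gamma> a)) \<Longrightarrow>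
      t * emeasure \<mu> A \<le> of_nat p * (\<integral>\<^sup>+ C. f C \<partial>\<nu>)"
    and g: "g \<in> G" and U: "compact U" "U \<subseteq> G" "U \<subseteq> Q" "mat 1 \<in> U"
    and v: "0 \<le> v" "ennreal v \<le> emeasure \<mu> U"
    and B: "B \<in> sets m" "emeasure m B < \<infinity>"
    and B\<^sub>1: "B\<^sub>1 \<in> variance_class act L \<nu> m \<beta> c" "B\<^sub>1 \<subseteq> (\<Inter>h\<in>U. (\<lambda>x. act x h) ` B)"
    and B\<^sub>2: "B\<^sub>2 \<in> variance_class act L \<nu> m \<beta> c" "(\<Union>h\<in>U. (\<lambda>x. act x h) ` B) \<subseteq> B\<^sub>2"
    and D: "measure m (B\<^sub>2 - B\<^sub>1) \<le> D"
    and "0 \<le> \<beta>" "0 \<le> c" "0 \<le> T"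
    and W: "real p * (c * ((measure m B + D) powr \<beta> + (measure m B + D))) < T\<^sup>2 * v"
  shows "finite ((\<lambda>x. act x g) ` L \<inter> B)"
    and "\<bar>real (card ((\<lambda>x. act x g) ` L \<inter> B)) - measure m B\<bar> \<le> D + T"
proof -
  let ?N = "card ((\<lambda>x. act x g) ` L \<inter> B)"
  have BV: "B \<subseteq> V" using sets.sets_into_space[OF B(1)] space_m by simp
  have id: "(\<lambda>x. act x (mat 1)) ` B = B"
    using BV act_mat_1 by force
  \<comment> \<open>The identity lies in \<open>U\<close>, so \<open>B\<close> itself is among its
    translates. Hence the measures of \<open>B\<^sub>1\<close> and \<open>B\<^sub>2\<close> both
    differ from that of \<open>B\<close> by at most \<open>D\<close>.\<close>
  have sub: "B\<^sub>1 \<subseteq> B" "B \<subseteq> B\<^sub>2"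
    using B\<^sub>1(2) B\<^sub>2(2) U(4) id by blast+
  have fm: "B\<^sub>1 \<in> fmeasurable m" "B\<^sub>2 \<in> fmeasurable m" "B \<in> fmeasurable m"
    using B\<^sub>1(1) B\<^sub>2(1) B by (auto simp: variance_class_def intro: fmeasurableI)
  have diff: "measure m (B\<^sub>2 - B\<^sub>1) = measure m B\<^sub>2 - measure m B\<^sub>1"
    using fm sub by (intro measurable_measure_Diff) auto
  have mono: "measure m B\<^sub>1 \<le> measure m B" "measure m B \<le> measure m B\<^sub>2"
    using fm sub by (auto intro!: measure_mono_fmeasurable)
  have D0: "0 \<le> D" using D measure_nonneg[of m "B\<^sub>2 - B\<^sub>1"] by linarith
  \<comment> \<open>The variance bound grows with the measure of \<open>S\<close>, so
    \<open>W\<close> excludes at once every admissible \<open>S\<close> of measure at most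
    \<open>measure m B + D\<close>. It is applied to \<open>B\<^sub>2\<close> for the upper bound
    and to \<open>B\<^sub>1\<close> for the lower one.\<close>
  have no_S: False if S: "S \<in> variance_class act L \<nu> m \<beta> c" "measure m S \<le> measure m B + D"
    and S': "\<And>h. h \<in> U \<Longrightarrow> ennreal T \<le> discrepancy m ((\<lambda>x. act x (g ** h)) ` L) S" for S
  proof -
    have "T\<^sup>2 * v \<le> real p * (c * (measure m S powr \<beta> + measure m S))"
      using variance_class_lower_bound[OF markov g U(1-3) v S(1) \<open>0 \<le> c\<close> \<open>0 \<le> T\<close> S'] .
    also have "\<dots> \<le> real p * (c * ((measure m B + D) powr \<beta> + (measure m B + D)))"
      using S(2) \<open>0 \<le> c\<close> \<open>0 \<le> \<beta>\<close>
      by (intro mult_left_mono add_mono powr_mono2) auto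
    finally show False using W by linarith
  qed
  have upper: "finite ((\<lambda>x. act x g) ` L \<inter> B) \<and> real ?N \<le> measure m B + D + T"
  proof (rule ccontr)
    assume *: "\<not> ?thesis"
    show False
    proof (rule no_S[OF B\<^sub>2(1)])
      show "measure m B\<^sub>2 \<le> measure m B + D" using diff mono D by linarith
      fix h assume h: "h \<in> U"
      let ?Y = "(\<lambda>x. act x (g ** h)) ` L \<inter> B\<^sub>2"
      have hG: "h \<in> G" and hB: "(\<lambda>x. act x h) ` B \<subseteq> B\<^sub>2" using h U(2) B\<^sub>2(2) by auto
      \<comment> \<open>If \<open>?Y\<close> is finite, so is the original intersection, and only
        its size can violate the bound; the term \<open>D\<close> pays for passing from
        \<open>B\<close> to \<open>B\<^sub>2\<close>. If \<open>?Y\<close> is infinite, its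
        discrepancy is infinite by definition.\<close>
      show "ennreal T \<le> discrepancy m ((\<lambda>x. act x (g ** h)) ` L) B\<^sub>2"
      proof (cases "finite ?Y")
        case True
        then have "measure m B + D + T < real (card ?Y)"
          using * card_translate_le[OF g hG BV hB True] by linarith
        then have "T \<le> \<bar>real (card ?Y) - measure m B\<^sub>2\<bar>"
          using diff mono D by linarith
        then show ?thesis
          using True by (simp add: discrepancy_def ennreal_leI)
      qed (simp add: discrepancy_def)
    qed
  qed
  then show fin: "finite ((\<lambda>x. act x g) ` L \<inter> B)" by simp
  have lower: "measure m B - D - T \<le> real ?N"
  proof (rule ccontr)
    assume *: "\<not> ?thesis"
    show False
    proof (rule no_S[OF B\<^sub>1(1)])
      show "measure m B\<^sub>1 \<le> measure m B + D" using mono D0 by linarith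
      fix h assume h: "h \<in> U"
      let ?Y = "(\<lambda>x. act x (g ** h)) ` L \<inter> B\<^sub>1"
      have hG: "h \<in> G" and hB: "B\<^sub>1 \<subseteq> (\<lambda>x. act x h) ` B" using h U(2) B\<^sub>1(2) by auto
      have Y: "finite ?Y" "real (card ?Y) < measure m B - D - T"
        using * card_translate_ge[OF g hG BV hB fin] by linarith+
      then have "T \<le> \<bar>real (card ?Y) - measure m B\<^sub>1\<bar>"
        using diff mono D by linarith
      then show "ennreal T \<le> discrepancy m ((\<lambda>x. act x (g ** h)) ` L) B\<^sub>1"
        using Y by (simp add: discrepancy_def ennreal_leI)
    qed
  qed
  show "\<bar>real ?N - measure m B\<bar> \<le> D + T"
    using upper lower by linarith
qed

end

section \<open>The choice of scale\<close>

text \<open>All claims become linear in \<open>ln \<delta>\<close> and \<open>ln M\<close>. The two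
  lower bounds on \<open>M\<close> amount to \<open>\<epsilon> \<le> 1\<close> and
  \<open>1 \<le> E\<close>, and their sum gives \<open>1 \<le> M\<close>. The last two equations
  express the balance: \<open>E\<close> is both the boundary error \<open>\<epsilon> * M\<close> and
  the square root of \<open>M powr \<beta> / (\<delta> * \<epsilon> powr d)\<close>.\<close>

lemma balanced_scale:
  fixes \<beta> d \<delta> M :: real
  defines "\<epsilon> \<equiv> \<delta> powr (- (1 / (d + 2))) * M powr (- ((2 - \<beta>) / (d + 2)))"
    and "E \<equiv> \<delta> powr (- (1 / (d + 2))) * M powr (1 - (2 - \<beta>) / (d + 2))"
  assumes \<beta>: "1 \<le> \<beta>" "\<beta> < 2" and d: "0 < d" and \<delta>: "0 < \<delta>"
    and M: "max (\<delta> powr (- (1 / (2 - \<beta>)))) (\<delta> powr (1 / (d + \<beta>))) \<le> M"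
  shows "1 \<le> M" "0 < \<epsilon>" "\<epsilon> \<le> 1" "\<epsilon> * M = E" "1 \<le> E" "\<delta> * \<epsilon> powr d * E\<^sup>2 = M powr \<beta>"
proof -
  have d\<beta>: "0 < d + \<beta>" using d \<beta> by simp
  have "0 < \<delta> powr (1 / (d + \<beta>))" using \<delta> by simp
  then have M0: "0 < M" using M by linarith
  have 1: "- ln \<delta> \<le> (2 - \<beta>) * ln M"
  proof -
    have "ln (\<delta> powr (- (1 / (2 - \<beta>)))) \<le> ln M"
      using M \<delta> M0 by (subst ln_le_cancel_iff) auto
    then show ?thesis using \<delta> \<beta> by (simp add: ln_powr field_simps)
  qed
  have 2: "ln \<delta> \<le> (d + \<beta>) * ln M"
  proof -
    have "ln (\<delta> powr (1 / (d + \<beta>))) \<le> ln M"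
      using M \<delta> M0 by (subst ln_le_cancel_iff) auto
    then show ?thesis using \<delta> d\<beta> by (simp add: ln_powr field_simps)
  qed
  have "0 \<le> (d + 2) * ln M" using 1 2 by (simp add: algebra_simps)
  then show "1 \<le> M" using d M0 by (simp add: zero_le_mult_iff)
  have \<epsilon>: "\<epsilon> = exp (- (ln \<delta> + (2 - \<beta>) * ln M) / (d + 2))"
    using \<delta> M0 by (simp add: \<epsilon>_def powr_def add_divide_distrib flip: exp_add)
      (simp only: diff_divide_distrib minus_divide_left)
  have "1 - (2 - \<beta>) / (d + 2) = (d + \<beta>) / (d + 2)"
    using d by (simp add: field_simps)
  then have E: "E = exp (((d + \<beta>) * ln M - ln \<delta>) / (d + 2))"
    using \<delta> M0 by (simp add: E_def powr_def diff_divide_distrib flip: exp_add)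
  show "0 < \<epsilon>" "\<epsilon> \<le> 1" "1 \<le> E"
    using 1 2 d by (auto simp: \<epsilon> E divide_simps)
  show "\<epsilon> * M = E"
    using M0 by (simp add: \<epsilon>_def E_def powr_diff powr_minus_divide)
  have "\<delta> * \<epsilon> powr d * E\<^sup>2 = exp (ln \<delta> + d * ln \<epsilon> + 2 * ln E)"
  proof -
    have "0 < \<epsilon>" "0 < E" by (simp_all add: \<epsilon> E)
    then show ?thesis
      using \<delta> unfolding exp_add by (simp add: powr_def exp_double)
  qed
  also have "ln \<delta> + d * ln \<epsilon> + 2 * ln E = \<beta> * ln M"
  proof -
    have eqs: "(d + 2) * ln \<epsilon> = - (ln \<delta> + (2 - \<beta>) * ln M)" "(d + 2) * ln E = (d + \<beta>) * ln M - ln \<delta>"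
      using d by (simp_all add: \<epsilon> E)
    have "(d + 2) * (ln \<delta> + d * ln \<epsilon> + 2 * ln E) =
        (d + 2) * ln \<delta> + d * ((d + 2) * ln \<epsilon>) + 2 * ((d + 2) * ln E)"
      by (simp add: algebra_simps)
    also have "\<dots> = (d + 2) * (\<beta> * ln M)"
      unfolding eqs by (simp add: algebra_simps)
    finally show ?thesis using d by simp
  qed
  finally show "\<delta> * \<epsilon> powr d * E\<^sup>2 = M powr \<beta>"
    using M0 by (simp add: powr_def)
qed

section \<open>The counting theorem with explicit constants\<close>

theorem theorem3p7:
  fixes V L :: "(real^'N) set"
    and G \<Gamma> :: "(real^'n^'n) set"
    and act :: "real^'N \<Rightarrow> real^'n^'n \<Rightarrow> real^'N"
    and \<mu> :: "(real^'n^'n) measure"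
    and \<nu> :: "(real^'n^'n) set measure"
    and m :: "(real^'N) measure"
    and \<beta> c :: real
  assumes "homogeneous_point_set V G \<Gamma> act L \<mu> \<nu> m"
    and "1 \<le> \<beta>" "\<beta> < 2" "0 < c"
  shows "\<exists>K :: real \<Rightarrow> real \<Rightarrow> real^'n^'n \<Rightarrow> real \<Rightarrow> real \<Rightarrow> (real^'n^'n) set \<Rightarrow> real.
    \<forall>\<O> \<delta> d \<eta> \<B> C\<^sub>0 \<epsilon>\<^sub>0.
      0 < \<delta> \<and> 0 < d \<and> 0 < \<eta> \<and>
      identity_neighbourhoods G \<mu> \<delta> d \<eta> \<O> \<and>
      \<B> \<subseteq> {B \<in> sets m. emeasure m B < \<infinity>} \<and>
      strongly_well_rounded act m (variance_class act L \<nu> m \<beta> c) \<O> C\<^sub>0 \<epsilon>\<^sub>0 \<B> \<longrightarrow>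
      (\<forall>g\<in>G. \<forall>B\<in>\<B>.
        max (\<delta> powr (- (1 / (2 - \<beta>)))) (\<delta> powr (1 / (d + \<beta>))) \<le> measure m B \<longrightarrow>
        finite ((\<lambda>x. act x g) ` L \<inter> B) \<and>
        \<bar>real (card ((\<lambda>x. act x g) ` L \<inter> B)) - measure m B\<bar>
          \<le> K d \<eta> g C\<^sub>0 \<epsilon>\<^sub>0 (\<O> 1) *
             (\<delta> powr (- (1 / (d + 2))) * measure m B powr (1 - (2 - \<beta>) / (d + 2))))"
proof -
  interpret homogeneous_point_set V G \<Gamma> act L \<mu> \<nu> m by (rule assms(1))
  \<comment> \<open>The covering number must be uniform in the scale. It is therefore chosen as a
    function of \<open>g\<close> and \<open>Q\<close> before any family of neighbourhoods is given,
    and used with \<open>Q = \<O> 1\<close>, which contains \<open>\<O> \<epsilon>\<close> at every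
    scale.\<close>
  have "\<exists>p :: nat. \<forall>A f t. A \<in> sets \<mu> \<longrightarrow> A \<subseteq> (**) g ` Q \<longrightarrow> (\<forall>a\<in>A. t \<le> f (rcoset \<Gamma> a)) \<longrightarrow>
      t * emeasure \<mu> A \<le> of_nat p * (\<integral>\<^sup>+ C. f C \<partial>\<nu>)"
    if "g \<in> G" "compact Q" "Q \<subseteq> G" for g and Q :: "(real^'n^'n) set"
  proof -
    have "compact ((**) g ` Q)"
      using that(2) by (rule compact_matrix_mult_image)
    moreover have "(**) g ` Q \<subseteq> G"
      using that mult_in_G by blast
    ultimately show ?thesis
      using haar_markov_inequality[of "(**) g ` Q"] by metis
  qed
  then obtain p :: "real^'n^'n \<Rightarrow> (real^'n^'n) set \<Rightarrow> nat" where
    p: "\<And>g Q A f t. g \<in> G \<Longrightarrow> compact Q \<Longrightarrow> Q \<subseteq> G \<Longrightarrow> A \<in> sets \<mu> \<Longrightarrow> A \<subseteq> (**) g ` Q \<Longrightarrow>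
      (\<And>a. a \<in> A \<Longrightarrow> t \<le> f (rcoset \<Gamma> a)) \<Longrightarrow>
      t * emeasure \<mu> A \<le> of_nat (p g Q) * (\<integral>\<^sup>+ C. f C \<partial>\<nu>)"
    by metis
  \<comment> \<open>This value is found by solving \<open>T\<^sup>2 * (\<delta> * \<epsilon> powr d)
    = (1 + p) * c * 2 * a\<^sup>2 * M powr \<beta>\<close> for \<open>T = K\<^sub>1 * E\<close>,
    where \<open>a = 1 + 2 * C\<^sub>0\<close>. Taking \<open>1 + p\<close> in place of
    \<open>p\<close> makes the required inequality strict, even for \<open>p = 0\<close>.\<close>
  define K\<^sub>1 where "K\<^sub>1 d g C\<^sub>0 \<epsilon>\<^sub>0 Q =
      (1 + 2 * C\<^sub>0) * sqrt (2 * c * (1 + real (p g Q)) / (\<epsilon>\<^sub>0 / 2) powr d)"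
    for d g C\<^sub>0 \<epsilon>\<^sub>0 Q
  show ?thesis
  proof (intro exI[of _ "\<lambda>d \<eta> g C\<^sub>0 \<epsilon>\<^sub>0 Q. 2 * C\<^sub>0 + K\<^sub>1 d g C\<^sub>0 \<epsilon>\<^sub>0 Q"] allI impI ballI, elim conjE)
    fix \<O> \<delta> d \<eta> \<B> C\<^sub>0 \<epsilon>\<^sub>0 g B
    assume \<delta>: "0 < \<delta>" and d: "0 < d"
      and nbhd: "identity_neighbourhoods G \<mu> \<delta> d \<eta> \<O>"
      and \<B>: "\<B> \<subseteq> {B \<in> sets m. emeasure m B < \<infinity>}"
      and wr: "strongly_well_rounded act m (variance_class act L \<nu> m \<beta> c) \<O> C\<^sub>0 \<epsilon>\<^sub>0 \<B>"
      and g: "g \<in> G" and B: "B \<in> \<B>"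
      and M: "max (\<delta> powr (- (1 / (2 - \<beta>)))) (\<delta> powr (1 / (d + \<beta>))) \<le> measure m B"
    define M where "M = measure m B"
    define E where "E = \<delta> powr (- (1 / (d + 2))) * M powr (1 - (2 - \<beta>) / (d + 2))"
    define \<epsilon>' where "\<epsilon>' = \<delta> powr (- (1 / (d + 2))) * M powr (- ((2 - \<beta>) / (d + 2)))"
    note scale = balanced_scale[OF assms(2,3) d \<delta> M, folded M_def, folded E_def \<epsilon>'_def]
    \<comment> \<open>The balanced scale is only known to be at most 1, whereas well-roundedness
      needs a scale below \<open>\<epsilon>\<^sub>0\<close>. The factor costs only the power
      \<open>(\<epsilon>\<^sub>0 / 2) powr d\<close> in the constant.\<close>
    define \<epsilon> where "\<epsilon> = \<epsilon>\<^sub>0 / 2 * \<epsilon>'"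
    define a where "a = 1 + 2 * C\<^sub>0"
    define T where "T = K\<^sub>1 d g C\<^sub>0 \<epsilon>\<^sub>0 (\<O> 1) * E"
    have C\<^sub>0: "0 \<le> C\<^sub>0" and \<epsilon>\<^sub>0: "0 < \<epsilon>\<^sub>0" "\<epsilon>\<^sub>0 < 1"
      using wr unfolding strongly_well_rounded_def by auto
    have a: "1 \<le> a" using C\<^sub>0 by (simp add: a_def)
    have "\<epsilon> \<le> \<epsilon>\<^sub>0 / 2" using mult_left_mono[OF scale(3), of "\<epsilon>\<^sub>0 / 2"] \<epsilon>\<^sub>0 by (simp add: \<epsilon>_def)
    moreover have "0 < \<epsilon>" using \<epsilon>\<^sub>0 scale(2) by (simp add: \<epsilon>_def)
    ultimately have \<epsilon>: "0 < \<epsilon>" "\<epsilon> < \<epsilon>\<^sub>0" "\<epsilon> \<le> 1" using \<epsilon>\<^sub>0 by linarith+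
    note nbhd\<^sub>1 = conjunct1[OF nbhd[unfolded identity_neighbourhoods_def], rule_format]
      and nbhd\<^sub>2 = conjunct1[OF conjunct2[OF nbhd[unfolded identity_neighbourhoods_def]], rule_format]
    have \<O>1: "compact (\<O> 1)" "\<O> 1 \<subseteq> G"
      using nbhd\<^sub>1[of 1] by simp_all
    have \<O>: "compact (\<O> \<epsilon>)" "\<O> \<epsilon> \<subseteq> G" "\<O> \<epsilon> \<subseteq> \<O> 1" "mat 1 \<in> \<O> \<epsilon>"
        "ennreal (\<delta> * \<epsilon> powr d) \<le> emeasure \<mu> (\<O> \<epsilon>)"
      using nbhd\<^sub>1[of \<epsilon>] nbhd\<^sub>2[of \<epsilon> 1] \<epsilon>(1,3) by blast+
    have "\<forall>\<epsilon>. 0 < \<epsilon> \<and> \<epsilon> < \<epsilon>\<^sub>0 \<longrightarrow> (\<forall>B\<in>\<B>.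
        \<exists>B\<^sub>1\<in>variance_class act L \<nu> m \<beta> c.
        \<exists>B\<^sub>2\<in>variance_class act L \<nu> m \<beta> c.
        B\<^sub>1 \<subseteq> (\<Inter>h\<in>\<O> \<epsilon>. (\<lambda>x. act x h) ` B) \<and> (\<Union>h\<in>\<O> \<epsilon>. (\<lambda>x. act x h) ` B) \<subseteq> B\<^sub>2 \<and>
        measure m (B\<^sub>2 - B\<^sub>1) \<le> C\<^sub>0 * (\<epsilon> * measure m B + 1) \<and> B\<^sub>2 - B\<^sub>1 \<in> variance_class act L \<nu> m \<beta> c)"
      using wr unfolding strongly_well_rounded_def by (elim conjE)
    from this[rule_format, OF conjI[OF \<epsilon>(1,2)] B]
    obtain B\<^sub>1 B\<^sub>2 where B\<^sub>1: "B\<^sub>1 \<in> variance_class act L \<nu> m \<beta> c" "B\<^sub>1 \<subseteq> (\<Inter>h\<in>\<O> \<epsilon>. (\<lambda>x. act x h) ` B)"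
      and B\<^sub>2: "B\<^sub>2 \<in> variance_class act L \<nu> m \<beta> c" "(\<Union>h\<in>\<O> \<epsilon>. (\<lambda>x. act x h) ` B) \<subseteq> B\<^sub>2"
      and D: "measure m (B\<^sub>2 - B\<^sub>1) \<le> C\<^sub>0 * (\<epsilon> * M + 1)"
      unfolding M_def by (elim bexE conjE)
    have "\<epsilon> * M \<le> E"
      using mult_right_mono[of "\<epsilon>\<^sub>0 / 2" 1 E] \<epsilon>\<^sub>0 scale(5)
      by (simp add: \<epsilon>_def mult.assoc scale(4) del: times_divide_eq_left)
    \<comment> \<open>Here \<open>1 \<le> E\<close> absorbs the additive 1 of
      well-roundedness.\<close>
    then have DE: "C\<^sub>0 * (\<epsilon> * M + 1) \<le> C\<^sub>0 * (2 * E)"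
      using scale(5) C\<^sub>0 by (intro mult_left_mono) auto
    \<comment> \<open>Since \<open>E = \<epsilon>' * M\<close> and
      \<open>\<epsilon>' \<le> 1\<close>, the enlarged measure stays within a factor
      \<open>a\<close> of \<open>M\<close>.\<close>
    have "C\<^sub>0 * (2 * E) \<le> C\<^sub>0 * (2 * M)"
      using scale(1-4) C\<^sub>0 mult_right_mono[of \<epsilon>' 1 M] by (intro mult_left_mono) auto
    then have ME: "M + C\<^sub>0 * (2 * E) \<le> a * M"
      by (simp add: a_def algebra_simps)
    have D': "measure m (B\<^sub>2 - B\<^sub>1) \<le> C\<^sub>0 * (2 * E)" using D DE by linarith
    have T0: "0 \<le> T" using a scale(5) assms(4) by (simp add: T_def K\<^sub>1_def a_def)
    have "(M + C\<^sub>0 * (2 * E)) powr \<beta> + (M + C\<^sub>0 * (2 * E)) \<le> (a * M) powr \<beta> + a * M"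
      using ME scale(1,5) C\<^sub>0 assms(2) by (intro add_mono powr_mono2) auto
    \<comment> \<open>With \<open>1 \<le> a\<close>, \<open>1 \<le> M\<close> and
      \<open>\<beta>\<close> between 1 and 2, both summands fit under the same bound, and the power
      of \<open>a\<close> no longer involves \<open>\<beta>\<close>.\<close>
    also have "\<dots> \<le> a\<^sup>2 * M powr \<beta> + a\<^sup>2 * M powr \<beta>"
    proof (rule add_mono)
      have "a powr \<beta> \<le> a powr 2" using a assms(3) by (intro powr_mono) auto
      then show "(a * M) powr \<beta> \<le> a\<^sup>2 * M powr \<beta>"
        using a scale(1) by (simp add: powr_mult mult_right_mono)
      have "M powr 1 \<le> M powr \<beta>" using scale(1) assms(2) by (intro powr_mono) auto
      moreover have "a \<le> a\<^sup>2" using a by (simp add: power2_eq_square)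
      ultimately show "a * M \<le> a\<^sup>2 * M powr \<beta>"
        using a scale(1) by (intro mult_mono) auto
    qed
    finally have "real (p g (\<O> 1)) * (c * ((M + C\<^sub>0 * (2 * E)) powr \<beta> + (M + C\<^sub>0 * (2 * E))))
        \<le> real (p g (\<O> 1)) * (c * (2 * (a\<^sup>2 * M powr \<beta>)))"
      using assms(4) by (intro mult_left_mono) (auto simp: mult_ac)
    also have "\<dots> < (1 + real (p g (\<O> 1))) * (c * (2 * (a\<^sup>2 * M powr \<beta>)))"
      using assms(4) a scale(1) by (intro mult_strict_right_mono) auto
    also have "\<dots> = T\<^sup>2 * (\<delta> * \<epsilon> powr d)"
    proof -
      have "T\<^sup>2 = a\<^sup>2 * (2 * c * (1 + real (p g (\<O> 1))) / (\<epsilon>\<^sub>0 / 2) powr d) * E\<^sup>2"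
        using assms(4) by (simp add: T_def K\<^sub>1_def a_def power_mult_distrib)
      moreover have "\<epsilon> powr d = (\<epsilon>\<^sub>0 / 2) powr d * \<epsilon>' powr d"
        unfolding \<epsilon>_def using \<epsilon>\<^sub>0 scale(2) by (subst powr_mult) auto
      moreover have "(\<epsilon>\<^sub>0 / 2) powr d \<noteq> 0" using \<epsilon>\<^sub>0 by simp
      ultimately show ?thesis
        unfolding scale(6)[symmetric] by (simp add: field_simps)
    qed
    finally have W: "real (p g (\<O> 1)) * (c * ((measure m B + C\<^sub>0 * (2 * E)) powr \<beta>
        + (measure m B + C\<^sub>0 * (2 * E)))) < T\<^sup>2 * (\<delta> * \<epsilon> powr d)"
      unfolding M_def .
    have "B \<in> sets m" "emeasure m B < \<infinity>" "0 \<le> \<delta> * \<epsilon> powr d" "0 \<le> \<beta>" "0 \<le> c"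
      using B \<B> \<delta> assms(2,4) by auto
    note dev = lattice_count_deviation[OF p[OF g \<O>1] g \<O>(1-4) this(3) \<O>(5) this(1,2) B\<^sub>1 B\<^sub>2 D'
      this(4,5) T0 W]
    have sum: "C\<^sub>0 * (2 * E) + T = (2 * C\<^sub>0 + K\<^sub>1 d g C\<^sub>0 \<epsilon>\<^sub>0 (\<O> 1)) * E"
      by (simp add: T_def algebra_simps)
    show "finite ((\<lambda>x. act x g) ` L \<inter> B) \<and>
        \<bar>real (card ((\<lambda>x. act x g) ` L \<inter> B)) - measure m B\<bar>
          \<le> (2 * C\<^sub>0 + K\<^sub>1 d g C\<^sub>0 \<epsilon>\<^sub>0 (\<O> 1)) *
             (\<delta> powr (- (1 / (d + 2))) * measure m B powr (1 - (2 - \<beta>) / (d + 2)))"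
      by (rule conjI[OF dev(1) dev(2)[unfolded sum, unfolded E_def M_def]])
  qed
qed

end
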